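(* For any finite Markov decision process, let $\mathcal{I}$ be a nonempty subinterval of $[0,1)$ (open, closed, or half-open; singletons allowed). Then $\mathcal{I}$ can be partitioned into finitely many turnpike intervals if and only if $N^*(\mathcal{I})<\infty$.
   Context: A finite Markov decision process (MDP) has a finite state set $\mathbb{X}=\{x^1,\ldots,x^m\}$, a finite nonempty action set $A(x)$ for each $x\in\mathbb{X}$, real one-step rewards $r(x,a)$, transition probabilities $p(\cdot|x,a)$ on $\mathbb{X}$, and a terminal reward $s:\mathbb{X}\to\mathbb{R}$. $\mathbb{F}$ is the set of decision rules (identified with deterministic policies), i.e. maps $\phi$ on $\mathbb{X}$ with $\phi(x)\in A(x)$. Functions on $\mathbb{X}$ are identified with vectors in $\mathbb{R}^m$. $P(\phi)$ is the stochastic matrix with entries $p(x^j|x^i,\phi(x^i))$ and $r(\phi)(x)=r(x,\phi(x))$. For $\alpha\in[0,1)$: $v_\alpha^\phi=\sum_{t=0}^\infty\alpha^tP(\phi)^tr(\phi)$; $V_\alpha(x)=\max_{\phi\in\mathbb{F}}v_\alpha^\phi(x)$; $T_\alpha^\phi V=r(\phi)+\alpha P(\phi)V$ for $V\in\mathbb{R}^m$; $V_{0,\alpha}=s$ and $V_{n,\alpha}(x)=\max_{\phi\in\mathbb{F}}T_\alpha^\phi V_{n-1,\alpha}(x)$ for $n\ge1$. Put $D_n(\alpha)=\{\phi\in\mathbb{F}:V_{n,\alpha}=T_\alpha^\phi V_{n-1,\alpha}\}$ for $n\in\{1,2,\ldots\}$ and $D(\alpha)=\{\phi\in\mathbb{F}:V_\alpha=v_\alpha^\phi\}$.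 The turnpike integer $N(\alpha)$ is the smallest positive integer such that $D_n(\alpha)\subset D(\alpha)$ for all $n\ge N(\alpha)$ (it is known to exist), and $N^*(E)=\sup_{\alpha\in E}N(\alpha)$ for $E\subset[0,1)$. A nonempty subinterval of $[0,1)$ (possibly a singleton) is called a turnpike interval if $N(\cdot)$ is constant on it. *)

theory Defs
  imports "HOL-Analysis.Analysis" "HOL-Library.Disjoint_Sets" "HOL-Library.Extended_Nat"
begin

text \<open>
  The states are the elements of a finite type \<open>'x\<close>; functions on the state set are the
  vectors in \<open>real ^ 'x\<close>.  The values of \<open>reward\<close> and \<open>trans\<close> at \<open>(x, a)\<close> with
  \<open>a \<notin> actions M x\<close> are never used; \<open>trans M x a y\<close> is $p(y|x,a)$.
\<close>

record ('x, 'a) mdp =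
  actions :: "'x \<Rightarrow> 'a set"
  reward :: "'x \<Rightarrow> 'a \<Rightarrow> real"
  trans :: "'x \<Rightarrow> 'a \<Rightarrow> 'x \<Rightarrow> real"
  terminal :: "'x \<Rightarrow> real"

definition finite_mdp :: "('x::finite, 'a) mdp \<Rightarrow> bool" where
  "finite_mdp M \<longleftrightarrow>
     (\<forall>x. finite (actions M x) \<and> actions M x \<noteq> {}) \<and>
     (\<forall>x. \<forall>a\<in>actions M x. (\<forall>y. 0 \<le> trans M x a y) \<and> (\<Sum>y\<in>UNIV. trans M x a y) = 1)"

definition decision_rules :: "('x::finite, 'a) mdp \<Rightarrow> ('x \<Rightarrow> 'a) set" where
  "decision_rules M = {\<phi>. \<forall>x. \<phi> x \<in> actions M x}"

definition trans_mat :: "('x::finite, 'a) mdp \<Rightarrow> ('x \<Rightarrow> 'a) \<Rightarrow> real ^ 'x ^ 'x" where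
  "trans_mat M \<phi> = (\<chi> x y. trans M x (\<phi> x) y)"

definition reward_vec :: "('x::finite, 'a) mdp \<Rightarrow> ('x \<Rightarrow> 'a) \<Rightarrow> real ^ 'x" where
  "reward_vec M \<phi> = (\<chi> x. reward M x (\<phi> x))"

primrec mat_power :: "real ^ 'n ^ 'n \<Rightarrow> nat \<Rightarrow> real ^ 'n ^ 'n" where
  "mat_power B 0 = mat 1"
| "mat_power B (Suc t) = B ** mat_power B t"

definition policy_value :: "('x::finite, 'a) mdp \<Rightarrow> real \<Rightarrow> ('x \<Rightarrow> 'a) \<Rightarrow> real ^ 'x" where
  "policy_value M \<alpha> \<phi> = (\<Sum>t. \<alpha> ^ t *\<^sub>R (mat_power (trans_mat M \<phi>) t *v reward_vec M \<phi>))"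

definition opt_value :: "('x::finite, 'a) mdp \<Rightarrow> real \<Rightarrow> real ^ 'x" where
  "opt_value M \<alpha> = (\<chi> x. Max ((\<lambda>\<phi>. policy_value M \<alpha> \<phi> $ x) ` decision_rules M))"

definition bellman :: "('x::finite, 'a) mdp \<Rightarrow> real \<Rightarrow> ('x \<Rightarrow> 'a) \<Rightarrow> real ^ 'x \<Rightarrow> real ^ 'x" where
  "bellman M \<alpha> \<phi> V = reward_vec M \<phi> + \<alpha> *\<^sub>R (trans_mat M \<phi> *v V)"

primrec value_iter :: "('x::finite, 'a) mdp \<Rightarrow> real \<Rightarrow> nat \<Rightarrow> real ^ 'x" where
  "value_iter M \<alpha> 0 = (\<chi> x. terminal M x)"
| "value_iter M \<alpha> (Suc n) =
     (\<chi> x. Max ((\<lambda>\<phi>. bellman M \<alpha> \<phi> (value_iter M \<alpha> n) $ x) ` decision_rules M))"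

text \<open>Only meaningful for \<open>n \<ge> 1\<close>.\<close>

definition opt_rules_at :: "('x::finite, 'a) mdp \<Rightarrow> real \<Rightarrow> nat \<Rightarrow> ('x \<Rightarrow> 'a) set" where
  "opt_rules_at M \<alpha> n =
     {\<phi> \<in> decision_rules M. value_iter M \<alpha> n = bellman M \<alpha> \<phi> (value_iter M \<alpha> (n - 1))}"

definition opt_rules :: "('x::finite, 'a) mdp \<Rightarrow> real \<Rightarrow> ('x \<Rightarrow> 'a) set" where
  "opt_rules M \<alpha> = {\<phi> \<in> decision_rules M. opt_value M \<alpha> = policy_value M \<alpha> \<phi>}"

definition turnpike_integer :: "('x::finite, 'a) mdp \<Rightarrow> real \<Rightarrow> nat" where
  "turnpike_integer M \<alpha> = (LEAST N. 1 \<le> N \<and> (\<forall>n\<ge>N. opt_rules_at M \<alpha> n \<subseteq> opt_rules M \<alpha>))"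

definition sup_turnpike :: "('x::finite, 'a) mdp \<Rightarrow> real set \<Rightarrow> enat" where
  "sup_turnpike M E = (SUP \<alpha>\<in>E. enat (turnpike_integer M \<alpha>))"

definition discount_interval :: "real set \<Rightarrow> bool" where
  "discount_interval I \<longleftrightarrow> I \<noteq> {} \<and> is_interval I \<and> I \<subseteq> {0..<1}"

definition turnpike_interval :: "('x::finite, 'a) mdp \<Rightarrow> real set \<Rightarrow> bool" where
  "turnpike_interval M J \<longleftrightarrow> discount_interval J \<and> turnpike_integer M constant_on J"

end

theory Submission
  imports Defs "HOL-Computational_Algebra.Polynomial"
begin

text \<open>
  Policy values are rational functions of the discount factor by Cramer's rule, and each iterate of
  value iteration is piecewise rational with finitely many pieces, so each inclusion
  $D_n(\alpha) \subset D(\alpha)$ changes its truth value only finitely often on $[0,1)$. If the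
  turnpike integer is bounded by $K$ on the interval, it is determined there by the inclusions with
  $n < K$, hence is constant off a finite set. This needs that the turnpike integer is a genuine
  minimum, which holds because value iteration converges.
\<close>

section \<open>Piecewise rational functions\<close>

text \<open>Each inclusion has its own finite set of exceptional discount factors, and a priori the
  union of these sets over all n may be infinite. A bound on the turnpike integer removes this
  obstacle: from the bound on, the inclusions hold throughout the interval and contribute no
  exceptional point. All finiteness comes from one dichotomy: a rational function without poles on
  [0,1) vanishes there identically or at finitely many points. Maxima over decision rules lead out
  of this class, hence the piecewise version. Its pieces are never enumerated: a property is
  demanded on every closed interval that misses a finite set \<open>F\<close>, so that combining two
  objects amounts to uniting their exceptional sets. The denominator in \<open>rat_fun\<close> has
  no zeros on [0,1), which makes the function continuous there and gives access to the intermediate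
  value theorem.\<close>

definition rat_fun :: "(real \<Rightarrow> real) \<Rightarrow> bool" where
  "rat_fun f \<longleftrightarrow> (\<exists>p q. \<forall>t\<in>{0..<1}. poly q t \<noteq> 0 \<and> f t = poly p t / poly q t)"

lemma rat_fun_const: "rat_fun (\<lambda>t. c)"
  unfolding rat_fun_def by (rule exI[of _ "[:c:]"], rule exI[of _ "[:1:]"]) simp

lemma rat_fun_ident: "rat_fun (\<lambda>t. t)"
  unfolding rat_fun_def by (rule exI[of _ "[:0, 1:]"], rule exI[of _ "[:1:]"]) simp

lemma rat_fun_add:
  assumes "rat_fun f" "rat_fun g"
  shows "rat_fun (\<lambda>t. f t + g t)"
proof -
  obtain p q p' q' where "\<forall>t\<in>{0..<1}. poly q t \<noteq> 0 \<and> f t = poly p t / poly q t"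
    "\<forall>t\<in>{0..<1}. poly q' t \<noteq> 0 \<and> g t = poly p' t / poly q' t"
    using assms unfolding rat_fun_def by blast
  then show ?thesis
    unfolding rat_fun_def
    by (intro exI[of _ "p * q' + p' * q"] exI[of _ "q * q'"]) (simp add: add_frac_eq)
qed

lemma rat_fun_mult:
  assumes "rat_fun f" "rat_fun g"
  shows "rat_fun (\<lambda>t. f t * g t)"
proof -
  obtain p q p' q' where "\<forall>t\<in>{0..<1}. poly q t \<noteq> 0 \<and> f t = poly p t / poly q t"
    "\<forall>t\<in>{0..<1}. poly q' t \<noteq> 0 \<and> g t = poly p' t / poly q' t"
    using assms unfolding rat_fun_def by blast
  then show ?thesis
    unfolding rat_fun_def
    by (intro exI[of _ "p * p'"] exI[of _ "q * q'"]) simp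
qed

lemma rat_fun_diff:
  assumes "rat_fun f" "rat_fun g"
  shows "rat_fun (\<lambda>t. f t - g t)"
  using rat_fun_add[OF assms(1) rat_fun_mult[OF rat_fun_const[of "-1"] assms(2)]] by simp

lemma rat_fun_divide:
  assumes "rat_fun f" "rat_fun g" "\<And>t. t \<in> {0..<1} \<Longrightarrow> g t \<noteq> 0"
  shows "rat_fun (\<lambda>t. f t / g t)"
proof -
  obtain p q p' q' where fg: "\<forall>t\<in>{0..<1}. poly q t \<noteq> 0 \<and> f t = poly p t / poly q t"
    "\<forall>t\<in>{0..<1}. poly q' t \<noteq> 0 \<and> g t = poly p' t / poly q' t"
    using assms unfolding rat_fun_def by blast
  \<comment> \<open>A zero of the numerator \<open>p'\<close> would be a zero of \<open>g\<close>;
    hence \<open>p'\<close> may move into the denominator.\<close>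
  then have "\<forall>t\<in>{0..<1}. poly p' t \<noteq> 0"
    using assms(3) by (metis div_0)
  with fg show ?thesis
    unfolding rat_fun_def
    by (intro exI[of _ "p * q'"] exI[of _ "q * p'"]) simp
qed

lemma rat_fun_sum: "(\<And>i. i \<in> A \<Longrightarrow> rat_fun (f i)) \<Longrightarrow> rat_fun (\<lambda>t. \<Sum>i\<in>A. f i t)"
  by (induction A rule: infinite_finite_induct) (auto intro: rat_fun_const rat_fun_add)

lemma rat_fun_prod: "(\<And>i. i \<in> A \<Longrightarrow> rat_fun (f i)) \<Longrightarrow> rat_fun (\<lambda>t. \<Prod>i\<in>A. f i t)"
  by (induction A rule: infinite_finite_induct) (auto intro: rat_fun_const rat_fun_mult)

text \<open>The Leibniz formula is a polynomial expression in the entries.\<close>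

lemma rat_fun_det:
  fixes A :: "real \<Rightarrow> real ^ 'n ^ 'n"
  assumes "\<And>i j. rat_fun (\<lambda>t. A t $ i $ j)"
  shows "rat_fun (\<lambda>t. det (A t))"
  unfolding det_def by (intro rat_fun_sum rat_fun_mult rat_fun_prod rat_fun_const assms)

lemma rat_fun_continuous_on:
  assumes "rat_fun f"
  shows "continuous_on {0..<1} f"
proof -
  obtain p q where pq: "\<forall>t\<in>{0..<1}. poly q t \<noteq> 0 \<and> f t = poly p t / poly q t"
    using assms unfolding rat_fun_def by blast
  then have "continuous_on {0..<1} (\<lambda>t. poly p t / poly q t)"
    by (intro continuous_intros) auto
  moreover have "continuous_on {0..<1} f = continuous_on {0..<1} (\<lambda>t. poly p t / poly q t)"
    using pq by (intro continuous_on_cong) auto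
  ultimately show ?thesis by simp
qed

lemma rat_fun_zeros:
  assumes "rat_fun f"
  shows "(\<forall>t\<in>{0..<1}. f t = 0) \<or> finite {t\<in>{0..<1}. f t = 0}"
proof -
  obtain p q where pq: "\<forall>t\<in>{0..<1}. poly q t \<noteq> 0 \<and> f t = poly p t / poly q t"
    using assms unfolding rat_fun_def by blast
  show ?thesis
  proof (cases "p = 0")
    case True
    with pq show ?thesis by simp
  next
    case False
    have "{t\<in>{0..<1}. f t = 0} \<subseteq> {t. poly p t = 0}" using pq by auto
    then show ?thesis using finite_subset poly_roots_finite[OF False] by blast
  qed
qed

text \<open>By the intermediate value theorem the sign can change only across a zero, so the zero
  set serves as \<open>F\<close>. The function that vanishes identically is treated apart, with
  \<open>F\<close> empty, because its zero set is infinite.\<close>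

lemma rat_fun_sgn:
  assumes "rat_fun f"
  shows "\<exists>F. finite F \<and>
    (\<forall>a b. 0 \<le> a \<longrightarrow> a \<le> b \<longrightarrow> b < 1 \<longrightarrow> {a..b} \<inter> F = {} \<longrightarrow> (\<forall>t\<in>{a..b}. sgn (f t) = sgn (f a)))"
  using rat_fun_zeros[OF assms]
proof
  assume "\<forall>t\<in>{0..<1}. f t = 0"
  then show ?thesis by (intro exI[of _ "{}"]) auto
next
  assume fin: "finite {t\<in>{0..<1}. f t = 0}"
  have "sgn (f t) = sgn (f a)"
    if ab: "0 \<le> a" "b < 1" "{a..b} \<inter> {t\<in>{0..<1}. f t = 0} = {}" and t: "t \<in> {a..b}" for a b t
  proof (rule ccontr)
    assume ne: "sgn (f t) \<noteq> sgn (f a)"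
    have nz: "f s \<noteq> 0" if "s \<in> {a..b}" for s
      using that ab by force
    have cont: "continuous_on {a..t} f"
      using ab t by (intro continuous_on_subset[OF rat_fun_continuous_on[OF assms]]) auto
    have "f a \<noteq> 0" "f t \<noteq> 0" using nz t by auto
    with ne consider "f a \<le> 0" "0 \<le> f t" | "f t \<le> 0" "0 \<le> f a"
      by (cases "f a > 0"; cases "f t > 0") auto
    then have "\<exists>s\<ge>a. s \<le> t \<and> f s = 0"
      using t cont by cases (auto intro: IVT' IVT2')
    with nz t show False by force
  qed
  with fin show ?thesis by blast
qed

text \<open>One finite set \<open>Q\<close> supplies the pieces for all gaps of \<open>F\<close>;
  the values at the points of \<open>F\<close> themselves are unconstrained.\<close>

definition pw_rat :: "(real \<Rightarrow> real) \<Rightarrow> bool" where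
  "pw_rat f \<longleftrightarrow> (\<exists>F Q. finite F \<and> finite Q \<and> (\<forall>g\<in>Q. rat_fun g) \<and>
    (\<forall>a b. 0 \<le> a \<longrightarrow> a \<le> b \<longrightarrow> b < 1 \<longrightarrow> {a..b} \<inter> F = {} \<longrightarrow> (\<exists>g\<in>Q. \<forall>t\<in>{a..b}. f t = g t)))"

lemma pw_ratI:
  assumes "finite F" "finite Q" "\<And>g. g \<in> Q \<Longrightarrow> rat_fun g"
    and "\<And>a b. 0 \<le> a \<Longrightarrow> a \<le> b \<Longrightarrow> b < 1 \<Longrightarrow> {a..b} \<inter> F = {} \<Longrightarrow> \<exists>g\<in>Q. \<forall>t\<in>{a..b}. f t = g t"
  shows "pw_rat f"
  using assms unfolding pw_rat_def by blast

lemma pw_ratE: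
  assumes "pw_rat f"
  obtains F Q where "finite F" "finite Q" "\<And>g. g \<in> Q \<Longrightarrow> rat_fun g"
    "\<And>a b. 0 \<le> a \<Longrightarrow> a \<le> b \<Longrightarrow> b < 1 \<Longrightarrow> {a..b} \<inter> F = {} \<Longrightarrow> \<exists>g\<in>Q. \<forall>t\<in>{a..b}. f t = g t"
proof -
  obtain F Q where FQ: "finite F" "finite Q" "\<forall>g\<in>Q. rat_fun g"
    "\<forall>a b. 0 \<le> a \<longrightarrow> a \<le> b \<longrightarrow> b < 1 \<longrightarrow> {a..b} \<inter> F = {} \<longrightarrow> (\<exists>g\<in>Q. \<forall>t\<in>{a..b}. f t = g t)"
    using assms unfolding pw_rat_def by blast
  show ?thesis by (rule that[of F Q]) (use FQ in blast)+
qed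

lemma rat_fun_imp_pw_rat: "rat_fun f \<Longrightarrow> pw_rat f"
  by (rule pw_ratI[of "{}" "{f}"]) auto

lemma pw_rat_binop:
  assumes "pw_rat f" "pw_rat g"
    and op: "\<And>p q. rat_fun p \<Longrightarrow> rat_fun q \<Longrightarrow> rat_fun (\<lambda>t. h (p t) (q t))"
  shows "pw_rat (\<lambda>t. h (f t) (g t))"
proof -
  obtain F Q where F: "finite F" "finite Q" "\<And>g. g \<in> Q \<Longrightarrow> rat_fun g"
    "\<And>a b. 0 \<le> a \<Longrightarrow> a \<le> b \<Longrightarrow> b < 1 \<Longrightarrow> {a..b} \<inter> F = {} \<Longrightarrow> \<exists>g\<in>Q. \<forall>t\<in>{a..b}. f t = g t"
    using pw_ratE[OF assms(1)] by blast
  obtain G R where G: "finite G" "finite R" "\<And>g. g \<in> R \<Longrightarrow> rat_fun g"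
    "\<And>a b. 0 \<le> a \<Longrightarrow> a \<le> b \<Longrightarrow> b < 1 \<Longrightarrow> {a..b} \<inter> G = {} \<Longrightarrow> \<exists>h\<in>R. \<forall>t\<in>{a..b}. g t = h t"
    using pw_ratE[OF assms(2)] by blast
  show ?thesis
  proof (rule pw_ratI[of "F \<union> G" "(\<lambda>(p, q) t. h (p t) (q t)) ` (Q \<times> R)"])
    fix a b :: real
    assume "0 \<le> a" "a \<le> b" "b < 1" "{a..b} \<inter> (F \<union> G) = {}"
    then obtain p q where "p \<in> Q" "\<forall>t\<in>{a..b}. f t = p t" "q \<in> R" "\<forall>t\<in>{a..b}. g t = q t"
      using F(4)[of a b] G(4)[of a b] by blast
    then show "\<exists>k\<in>(\<lambda>(p, q) t. h (p t) (q t)) ` (Q \<times> R). \<forall>t\<in>{a..b}. h (f t) (g t) = k t"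
      by (intro bexI[of _ "\<lambda>t. h (p t) (q t)"]) auto
  qed (use F G op in auto)
qed

lemma pw_rat_add: "pw_rat f \<Longrightarrow> pw_rat g \<Longrightarrow> pw_rat (\<lambda>t. f t + g t)"
  by (rule pw_rat_binop) (auto intro: rat_fun_add)

lemma pw_rat_diff: "pw_rat f \<Longrightarrow> pw_rat g \<Longrightarrow> pw_rat (\<lambda>t. f t - g t)"
  by (rule pw_rat_binop) (auto intro: rat_fun_diff)

lemma pw_rat_mult: "pw_rat f \<Longrightarrow> pw_rat g \<Longrightarrow> pw_rat (\<lambda>t. f t * g t)"
  by (rule pw_rat_binop) (auto intro: rat_fun_mult)

lemma pw_rat_sum: "(\<And>i. i \<in> A \<Longrightarrow> pw_rat (f i)) \<Longrightarrow> pw_rat (\<lambda>t. \<Sum>i\<in>A. f i t)"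
  by (induction A rule: infinite_finite_induct)
    (auto intro: rat_fun_imp_pw_rat rat_fun_const pw_rat_add)

text \<open>Which member of \<open>Q\<close> is active on a given interval is unknown, so the
  exceptional points of all of them are removed. The union stays finite because \<open>Q\<close> is
  finite.\<close>

lemma pw_rat_sgn:
  assumes "pw_rat f"
  shows "\<exists>F. finite F \<and>
    (\<forall>a b. 0 \<le> a \<longrightarrow> a \<le> b \<longrightarrow> b < 1 \<longrightarrow> {a..b} \<inter> F = {} \<longrightarrow> (\<forall>t\<in>{a..b}. sgn (f t) = sgn (f a)))"
proof -
  obtain F Q where F: "finite F" "finite Q" "\<And>g. g \<in> Q \<Longrightarrow> rat_fun g"
    "\<And>a b. 0 \<le> a \<Longrightarrow> a \<le> b \<Longrightarrow> b < 1 \<Longrightarrow> {a..b} \<inter> F = {} \<Longrightarrow> \<exists>g\<in>Q. \<forall>t\<in>{a..b}. f t = g t"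
    using pw_ratE[OF assms] by blast
  have "\<forall>g\<in>Q. \<exists>G. finite G \<and>
    (\<forall>a b. 0 \<le> a \<longrightarrow> a \<le> b \<longrightarrow> b < 1 \<longrightarrow> {a..b} \<inter> G = {} \<longrightarrow> (\<forall>t\<in>{a..b}. sgn (g t) = sgn (g a)))"
    using F(3) rat_fun_sgn by blast
  then obtain G where G: "\<And>g. g \<in> Q \<Longrightarrow> finite (G g)"
    "\<And>g a b t. g \<in> Q \<Longrightarrow> 0 \<le> a \<Longrightarrow> a \<le> b \<Longrightarrow> b < 1 \<Longrightarrow> {a..b} \<inter> G g = {} \<Longrightarrow> t \<in> {a..b} \<Longrightarrow> sgn (g t) = sgn (g a)"
    by metis
  show ?thesis
  proof (intro exI[of _ "F \<union> (\<Union>g\<in>Q. G g)"] conjI allI impI ballI)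
    show "finite (F \<union> (\<Union>g\<in>Q. G g))" using F G by auto
    fix a b t :: real
    assume ab: "0 \<le> a" "a \<le> b" "b < 1" "{a..b} \<inter> (F \<union> (\<Union>g\<in>Q. G g)) = {}" and t: "t \<in> {a..b}"
    then obtain g where g: "g \<in> Q" "\<forall>t\<in>{a..b}. f t = g t"
      using F(4)[of a b] by blast
    have "sgn (g t) = sgn (g a)" using g ab t by (intro G(2)[of g a b]) auto
    with g t ab show "sgn (f t) = sgn (f a)" by simp
  qed
qed

text \<open>Away from the sign changes of \<open>f - g\<close> the maximum is the same one of the
  two functions along the whole interval, so the old pieces suffice and only \<open>F\<close>
  grows.\<close>

lemma pw_rat_max:
  assumes f: "pw_rat f" and g: "pw_rat g"
  shows "pw_rat (\<lambda>t. max (f t) (g t))"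
proof -
  obtain F Q where F: "finite F" "finite Q" "\<And>g. g \<in> Q \<Longrightarrow> rat_fun g"
    "\<And>a b. 0 \<le> a \<Longrightarrow> a \<le> b \<Longrightarrow> b < 1 \<Longrightarrow> {a..b} \<inter> F = {} \<Longrightarrow> \<exists>g\<in>Q. \<forall>t\<in>{a..b}. f t = g t"
    using pw_ratE[OF f] by blast
  obtain G R where G: "finite G" "finite R" "\<And>g. g \<in> R \<Longrightarrow> rat_fun g"
    "\<And>a b. 0 \<le> a \<Longrightarrow> a \<le> b \<Longrightarrow> b < 1 \<Longrightarrow> {a..b} \<inter> G = {} \<Longrightarrow> \<exists>h\<in>R. \<forall>t\<in>{a..b}. g t = h t"
    using pw_ratE[OF g] by blast
  obtain H where H: "finite H"
    "\<And>a b t. 0 \<le> a \<Longrightarrow> a \<le> b \<Longrightarrow> b < 1 \<Longrightarrow> {a..b} \<inter> H = {} \<Longrightarrow> t \<in> {a..b} \<Longrightarrow> sgn (f t - g t) = sgn (f a - g a)"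
    using pw_rat_sgn[OF pw_rat_diff[OF f g]] by blast
  show ?thesis
  proof (rule pw_ratI[of "F \<union> G \<union> H" "Q \<union> R"])
    fix a b :: real
    assume ab: "0 \<le> a" "a \<le> b" "b < 1" "{a..b} \<inter> (F \<union> G \<union> H) = {}"
    then obtain p q where pq: "p \<in> Q" "\<forall>t\<in>{a..b}. f t = p t" "q \<in> R" "\<forall>t\<in>{a..b}. g t = q t"
      using F(4)[of a b] G(4)[of a b] by blast
    have s: "sgn (f t - g t) = sgn (f a - g a)" if "t \<in> {a..b}" for t
      using ab that by (intro H(2)[of a b]) auto
    show "\<exists>k\<in>Q \<union> R. \<forall>t\<in>{a..b}. max (f t) (g t) = k t"
    proof (cases "f a \<ge> g a")
      case True
      have "f t \<ge> g t" if "t \<in> {a..b}" for t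
        using s[OF that] True by (auto simp: sgn_if split: if_splits)
      with pq show ?thesis by (intro bexI[of _ p]) (auto simp: max_def intro: antisym)
    next
      case False
      have "max (f t) (g t) = g t" if "t \<in> {a..b}" for t
        using s[OF that] False by (auto simp: sgn_if max_def split: if_splits)
      with pq show ?thesis by (intro bexI[of _ q]) auto
    qed
  qed (use F G H in auto)
qed

lemma pw_rat_Max:
  assumes "finite A" "A \<noteq> {}" "\<And>i. i \<in> A \<Longrightarrow> pw_rat (f i)"
  shows "pw_rat (\<lambda>t. Max ((\<lambda>i. f i t) ` A))"
  using assms
proof (induction rule: finite_ne_induct)
  case (insert i A)
  then have "Max ((\<lambda>i. f i t) ` insert i A) = max (f i t) (Max ((\<lambda>i. f i t) ` A))" for t
    by simp
  with insert show ?case by (simp add: pw_rat_max)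
qed simp

section \<open>Tame predicates\<close>

text \<open>Comparing endpoints is enough: every subinterval of \<open>{a..b}\<close> misses
  \<open>F\<close> as well, so the truth value is constant on \<open>{a..b}\<close>.\<close>

definition tame :: "(real \<Rightarrow> bool) \<Rightarrow> bool" where
  "tame P \<longleftrightarrow> (\<exists>F. finite F \<and>
    (\<forall>a b. 0 \<le> a \<longrightarrow> a \<le> b \<longrightarrow> b < 1 \<longrightarrow> {a..b} \<inter> F = {} \<longrightarrow> P a = P b))"

text \<open>Both relations depend only on the sign of \<open>f - g\<close>.\<close>

lemma tame_pw_rat:
  assumes "pw_rat f" "pw_rat g"
  shows tame_eq: "tame (\<lambda>t. f t = g t)" and tame_le: "tame (\<lambda>t. f t \<le> g t)"
proof -
  obtain H where H: "finite H"
    "\<And>a b t. 0 \<le> a \<Longrightarrow> a \<le> b \<Longrightarrow> b < 1 \<Longrightarrow> {a..b} \<inter> H = {} \<Longrightarrow> t \<in> {a..b} \<Longrightarrow> sgn (f t - g t) = sgn (f a - g a)"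
    using pw_rat_sgn[OF pw_rat_diff[OF assms]] by blast
  have sgn_eq: "sgn (f b - g b) = sgn (f a - g a)" if "0 \<le> a" "a \<le> b" "b < 1" "{a..b} \<inter> H = {}" for a b
    using that by (intro H(2)) auto
  have "(f a = g a) = (f b = g b) \<and> (f a \<le> g a) = (f b \<le> g b)"
    if "0 \<le> a" "a \<le> b" "b < 1" "{a..b} \<inter> H = {}" for a b
  proof -
    have "(x = 0) = (y = 0) \<and> (x \<le> 0) = (y \<le> 0)" if "sgn x = sgn y" for x y :: real
      using that by (auto simp: sgn_if split: if_splits)
    from this[OF sgn_eq[OF that]] show ?thesis by auto
  qed
  with H(1) show "tame (\<lambda>t. f t = g t)" "tame (\<lambda>t. f t \<le> g t)"
    unfolding tame_def by blast+
qed

text \<open>A single exceptional set controls every member of the family separately. The turnpike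
  integer needs this form, since it depends on the individual inclusions and not merely on their
  conjunction.\<close>

lemma tame_common:
  assumes "finite A" "\<And>i. i \<in> A \<Longrightarrow> tame (P i)"
  obtains F where "finite F"
    "\<And>i a b. i \<in> A \<Longrightarrow> 0 \<le> a \<Longrightarrow> a \<le> b \<Longrightarrow> b < 1 \<Longrightarrow> {a..b} \<inter> F = {} \<Longrightarrow> P i a = P i b"
proof -
  have "\<forall>i\<in>A. \<exists>F. finite F \<and>
    (\<forall>a b. 0 \<le> a \<longrightarrow> a \<le> b \<longrightarrow> b < 1 \<longrightarrow> {a..b} \<inter> F = {} \<longrightarrow> P i a = P i b)"
    using assms(2) unfolding tame_def by blast
  then obtain F where F: "\<And>i. i \<in> A \<Longrightarrow> finite (F i)"
    "\<And>i a b. i \<in> A \<Longrightarrow> 0 \<le> a \<Longrightarrow> a \<le> b \<Longrightarrow> b < 1 \<Longrightarrow> {a..b} \<inter> F i = {} \<Longrightarrow> P i a = P i b"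
    by metis
  show ?thesis
  proof (rule that[of "\<Union>i\<in>A. F i"])
    show "finite (\<Union>i\<in>A. F i)" using F assms by auto
    show "P i a = P i b" if "i \<in> A" "0 \<le> a" "a \<le> b" "b < 1" "{a..b} \<inter> (\<Union>i\<in>A. F i) = {}" for i a b
      using that by (intro F(2)) auto
  qed
qed

lemma tame_ball:
  assumes "finite A" "\<And>i. i \<in> A \<Longrightarrow> tame (P i)"
  shows "tame (\<lambda>t. \<forall>i\<in>A. P i t)"
proof (rule tame_common[of A P])
  fix F
  assume F: "finite F"
    "\<And>i a b. i \<in> A \<Longrightarrow> 0 \<le> a \<Longrightarrow> a \<le> b \<Longrightarrow> b < 1 \<Longrightarrow> {a..b} \<inter> F = {} \<Longrightarrow> P i a = P i b"
  have "(\<forall>i\<in>A. P i a) = (\<forall>i\<in>A. P i b)" if "0 \<le> a" "a \<le> b" "b < 1" "{a..b} \<inter> F = {}" for a b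
    using F(2)[OF _ that] by simp
  with F(1) show "tame (\<lambda>t. \<forall>i\<in>A. P i t)" unfolding tame_def by blast
qed (use assms in auto)

lemma tame_imp:
  assumes "tame P" "tame Q"
  shows "tame (\<lambda>t. P t \<longrightarrow> Q t)"
proof -
  obtain F G where "finite F" "finite G"
    "\<And>a b. 0 \<le> a \<Longrightarrow> a \<le> b \<Longrightarrow> b < 1 \<Longrightarrow> {a..b} \<inter> F = {} \<Longrightarrow> P a = P b"
    "\<And>a b. 0 \<le> a \<Longrightarrow> a \<le> b \<Longrightarrow> b < 1 \<Longrightarrow> {a..b} \<inter> G = {} \<Longrightarrow> Q a = Q b"
    using assms unfolding tame_def by metis
  then show ?thesis unfolding tame_def
    by (intro exI[of _ "F \<union> G"]) (simp add: Int_Un_distrib)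
qed

lemma tame_cong:
  assumes "tame P" "\<And>t. 0 \<le> t \<Longrightarrow> t < 1 \<Longrightarrow> P t = Q t"
  shows "tame Q"
proof -
  obtain F where F: "finite F"
    "\<And>a b. 0 \<le> a \<Longrightarrow> a \<le> b \<Longrightarrow> b < 1 \<Longrightarrow> {a..b} \<inter> F = {} \<Longrightarrow> P a = P b"
    using assms(1) unfolding tame_def by metis
  have "Q a = Q b" if "0 \<le> a" "a \<le> b" "b < 1" "{a..b} \<inter> F = {}" for a b
    using F(2)[OF that] assms(2)[of a] assms(2)[of b] that by auto
  with F(1) show ?thesis unfolding tame_def by blast
qed

text \<open>The pieces are the fibres of \<open>a \<mapsto> (F \<inter> {..<a}, F \<inter> {..a})\<close>: the points of \<open>F\<close> and the gaps
  between them.\<close>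

lemma finite_interval_partition:
  fixes F I :: "real set"
  assumes "finite F" "is_interval I"
  obtains \<P> where "finite \<P>" "partition_on I \<P>"
    "\<And>J. J \<in> \<P> \<Longrightarrow> is_interval J"
    "\<And>J a b. J \<in> \<P> \<Longrightarrow> a \<in> J \<Longrightarrow> b \<in> J \<Longrightarrow> a < b \<Longrightarrow> {a..b} \<inter> F = {}"
proof -
  \<comment> \<open>The first component alone would merge a point of \<open>F\<close> with the gap
    on its left, the second alone with the gap on its right.\<close>
  define g where "g a = (F \<inter> {..<a}, F \<inter> {..a})" for a
  define \<P> where "\<P> = (\<lambda>y. I \<inter> g -` {y}) ` g ` I"
  have fin: "finite \<P>"
  proof -
    have "g ` I \<subseteq> Pow F \<times> Pow F" by (auto simp: g_def)
    then have "finite (g ` I)" using assms(1) by (meson finite_Pow_iff finite_SigmaI finite_subset)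
    then show ?thesis by (simp add: \<P>_def)
  qed
  have part: "partition_on I \<P>"
    by (rule partition_onI) (auto simp: \<P>_def disjnt_def)
  have int: "is_interval J" if J: "J \<in> \<P>" for J
  proof -
    obtain y where y: "J = I \<inter> g -` {y}" using J by (auto simp: \<P>_def)
    have "c \<in> J" if "a \<in> J" "b \<in> J" "a \<le> c" "c \<le> b" for a b c
    proof -
      have "c \<in> I" using that y assms(2) by (meson IntD1 is_interval_1)
      \<comment> \<open>Both components of \<open>g\<close> are monotone, so at \<open>c\<close>
        they are squeezed between their equal values at \<open>a\<close> and
        \<open>b\<close>.\<close>
      moreover have "F \<inter> {..<a} \<subseteq> F \<inter> {..<c}" "F \<inter> {..<c} \<subseteq> F \<inter> {..<b}"
        "F \<inter> {..a} \<subseteq> F \<inter> {..c}" "F \<inter> {..c} \<subseteq> F \<inter> {..b}"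
        using that by auto
      moreover have "g a = y" "g b = y" using that y by auto
      ultimately have "g c = y" unfolding g_def by auto
      with \<open>c \<in> I\<close> y show ?thesis by simp
    qed
    then show ?thesis unfolding is_interval_1 by blast
  qed
  \<comment> \<open>The strict inequality leaves out the pieces that consist of a single point of
    \<open>F\<close>.\<close>
  have gap: "{a..b} \<inter> F = {}" if "J \<in> \<P>" "a \<in> J" "b \<in> J" "a < b" for J a b
  proof (rule ccontr)
    assume "{a..b} \<inter> F \<noteq> {}"
    then obtain c where c: "c \<in> F" "a \<le> c" "c \<le> b" by auto
    have "g a = g b" using that by (auto simp: \<P>_def)
    then have eq: "F \<inter> {..<a} = F \<inter> {..<b}" "F \<inter> {..a} = F \<inter> {..b}" by (auto simp: g_def)
    have "c \<in> F \<inter> {..b}" using c by auto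
    then have "c \<le> a" using eq(2) by auto
    then have "c \<in> F \<inter> {..<b}" using c that by auto
    then have "c < a" using eq(1) by auto
    with c show False by simp
  qed
  show ?thesis by (rule that[OF fin part int gap])
qed

section \<open>Discounted policies\<close>

lemma finite_decision_rules:
  assumes "finite_mdp M"
  shows "finite (decision_rules M)"
proof -
  have "decision_rules M = PiE UNIV (actions M)"
    by (auto simp: decision_rules_def)
  then show ?thesis using assms by (simp add: finite_PiE finite_mdp_def)
qed

lemma decision_rules_nonempty:
  assumes "finite_mdp M"
  shows "decision_rules M \<noteq> {}"
proof -
  have "(\<lambda>x. SOME a. a \<in> actions M x) \<in> decision_rules M"
    using assms by (auto simp: decision_rules_def finite_mdp_def some_in_eq)
  then show ?thesis by blast
qed

lemma trans_mat_nonneg: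
  "finite_mdp M \<Longrightarrow> \<phi> \<in> decision_rules M \<Longrightarrow> 0 \<le> trans_mat M \<phi> $ x $ y"
  by (auto simp: finite_mdp_def decision_rules_def trans_mat_def)

lemma trans_mat_sum:
  "finite_mdp M \<Longrightarrow> \<phi> \<in> decision_rules M \<Longrightarrow> (\<Sum>y\<in>UNIV. trans_mat M \<phi> $ x $ y) = 1"
  by (auto simp: finite_mdp_def decision_rules_def trans_mat_def)

text \<open>Each row is a probability vector, so the entry is an average of values that are at least
  \<open>c\<close>.\<close>

lemma trans_mat_ge:
  assumes "finite_mdp M" "\<phi> \<in> decision_rules M" "\<And>y. c \<le> u $ y"
  shows "c \<le> (trans_mat M \<phi> *v u) $ x"
proof -
  have "c = (\<Sum>y\<in>UNIV. trans_mat M \<phi> $ x $ y * c)"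
    using trans_mat_sum[OF assms(1,2)] by (simp flip: sum_distrib_right)
  also have "\<dots> \<le> (\<Sum>y\<in>UNIV. trans_mat M \<phi> $ x $ y * u $ y)"
    by (intro sum_mono mult_left_mono assms trans_mat_nonneg)
  finally show ?thesis by (simp add: matrix_vector_mult_def)
qed

lemma trans_mat_abs_le:
  assumes "finite_mdp M" "\<phi> \<in> decision_rules M" "\<And>y. \<bar>u $ y\<bar> \<le> c"
  shows "\<bar>(trans_mat M \<phi> *v u) $ x\<bar> \<le> c"
proof -
  have lo: "- c \<le> u $ y" and up: "- c \<le> (- u) $ y" for y
    using assms(3)[of y] by auto
  have "- c \<le> (trans_mat M \<phi> *v u) $ x" "- c \<le> (trans_mat M \<phi> *v (- u)) $ x"
    by (rule trans_mat_ge[OF assms(1,2) lo], rule trans_mat_ge[OF assms(1,2) up])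
  moreover have "trans_mat M \<phi> *v (- u) = - (trans_mat M \<phi> *v u)"
    by (simp add: vec_eq_iff matrix_vector_mult_def sum_negf)
  ultimately show ?thesis by auto
qed

text \<open>Evaluate the hypothesis at a state where \<open>u\<close> is minimal.\<close>

lemma superharmonic_nonneg:
  fixes u :: "real ^ 'x::finite"
  assumes "finite_mdp M" "\<phi> \<in> decision_rules M" "0 \<le> \<alpha>" "\<alpha> < 1"
    and "\<And>x. \<alpha> * (trans_mat M \<phi> *v u) $ x \<le> u $ x"
  shows "0 \<le> u $ x"
proof -
  define m where "m = Min (range (($) u))"
  have le: "m \<le> u $ y" for y by (simp add: m_def)
  have "m \<in> range (($) u)" unfolding m_def by (rule Min_in) auto
  then obtain z where z: "m = u $ z" by auto
  have "\<alpha> * m \<le> \<alpha> * (trans_mat M \<phi> *v u) $ z"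
    by (intro mult_left_mono trans_mat_ge assms le)
  also have "\<dots> \<le> m" using assms(5) z by simp
  finally have "0 \<le> (1 - \<alpha>) * m" by (simp add: algebra_simps)
  then have "0 \<le> m" using assms(4) by (simp add: zero_le_mult_iff)
  with le[of x] show ?thesis by linarith
qed

text \<open>Both \<open>u\<close> and \<open>- u\<close> satisfy the superharmonic inequality. The
  result is the injectivity of I - \<alpha>P, which yields uniqueness of fixed points as well as the
  nonzero determinant in Cramer's rule.\<close>

lemma harmonic_zero:
  fixes u :: "real ^ 'x::finite"
  assumes "finite_mdp M" "\<phi> \<in> decision_rules M" "0 \<le> \<alpha>" "\<alpha> < 1"
    and "u = \<alpha> *\<^sub>R (trans_mat M \<phi> *v u)"
  shows "u = 0"
proof -
  have eq: "u $ x = \<alpha> * (trans_mat M \<phi> *v u) $ x" for x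
    using arg_cong[OF assms(5), of "\<lambda>v. v $ x"] by simp
  have neg: "trans_mat M \<phi> *v (- u) = - (trans_mat M \<phi> *v u)"
    by (simp add: vec_eq_iff matrix_vector_mult_def sum_negf)
  have "0 \<le> u $ x" for x
    using eq by (intro superharmonic_nonneg[OF assms(1-4)]) (metis order_refl)
  moreover have "0 \<le> (- u) $ x" for x
    using eq by (intro superharmonic_nonneg[OF assms(1-4)]) (simp add: neg)
  ultimately show ?thesis by (simp add: vec_eq_iff antisym)
qed

text \<open>A stochastic matrix does not increase the maximum norm, so the series is dominated by a
  geometric one. Splitting off its head and pulling the bounded linear map \<alpha>P out of the tail
  gives the equation.\<close>

lemma policy_value_fixpoint:
  fixes M :: "('x::finite, 'a) mdp"
  assumes "finite_mdp M" "\<phi> \<in> decision_rules M" "0 \<le> \<alpha>" "\<alpha> < 1"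
  shows "policy_value M \<alpha> \<phi> = bellman M \<alpha> \<phi> (policy_value M \<alpha> \<phi>)"
proof -
  define P where "P = trans_mat M \<phi>"
  define r where "r = reward_vec M \<phi>"
  define w where "w t = mat_power P t *v r" for t
  have w0: "w 0 = r" and wSuc: "w (Suc t) = P *v w t" for t
    by (simp_all add: w_def matrix_vector_mul_assoc)
  define B where "B = Max (range (\<lambda>x. \<bar>r $ x\<bar>))"
  have wB: "\<bar>w t $ x\<bar> \<le> B" for t x
  proof (induction t arbitrary: x)
    case 0
    show ?case by (simp add: w0 B_def)
  next
    case (Suc t)
    then show ?case unfolding wSuc P_def by (intro trans_mat_abs_le assms)
  qed
  have summ: "summable (\<lambda>t. \<alpha> ^ t *\<^sub>R w t)"
  proof (rule summable_comparison_test'[where N = 0])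
    \<comment> \<open>The factor \<open>CARD('x)\<close> arises from bounding the Euclidean norm by
      the sum of the absolute values of the coordinates.\<close>
    show "summable (\<lambda>t. (CARD('x) * B) * \<alpha> ^ t)"
      using assms by (intro summable_mult summable_geometric) auto
    fix t :: nat
    have "norm (w t) \<le> (\<Sum>x\<in>UNIV. \<bar>w t $ x\<bar>)" by (rule norm_le_l1_cart)
    also have "\<dots> \<le> CARD('x) * B" by (intro sum_bounded_above wB)
    finally show "norm (\<alpha> ^ t *\<^sub>R w t) \<le> (CARD('x) * B) * \<alpha> ^ t"
      using assms by (simp add: mult.commute mult_left_mono)
  qed
  have pv: "policy_value M \<alpha> \<phi> = (\<Sum>t. \<alpha> ^ t *\<^sub>R w t)"
    by (simp add: policy_value_def w_def P_def r_def)
  have bl: "bounded_linear (\<lambda>v. \<alpha> *\<^sub>R (P *v v))"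
    by (intro bounded_linear_intros) (rule matrix_vector_mul_bounded_linear)
  have "(\<Sum>t. \<alpha> ^ t *\<^sub>R w t) = r + (\<Sum>t. \<alpha> ^ Suc t *\<^sub>R w (Suc t))"
    using suminf_split_head[OF summ] by (simp add: w0)
  also have "(\<Sum>t. \<alpha> ^ Suc t *\<^sub>R w (Suc t)) = (\<Sum>t. \<alpha> *\<^sub>R (P *v (\<alpha> ^ t *\<^sub>R w t)))"
    by (simp add: wSuc matrix_vector_mult_scaleR)
  also have "\<dots> = \<alpha> *\<^sub>R (P *v (\<Sum>t. \<alpha> ^ t *\<^sub>R w t))"
    by (rule bounded_linear.suminf[OF bl summ, symmetric])
  finally show ?thesis by (simp add: pv bellman_def P_def r_def)
qed

text \<open>Subtracting the fixed-point equation of the policy value shows that \<open>W - v\<close>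
  is superharmonic. With the limit of value iteration as \<open>W\<close>, this bounds all policies
  at once.\<close>

lemma policy_value_le:
  assumes "finite_mdp M" "\<phi> \<in> decision_rules M" "0 \<le> \<alpha>" "\<alpha> < 1"
    and "\<And>x. bellman M \<alpha> \<phi> W $ x \<le> W $ x"
  shows "policy_value M \<alpha> \<phi> $ x \<le> W $ x"
proof -
  define v where "v = policy_value M \<alpha> \<phi>"
  have v: "v $ x = bellman M \<alpha> \<phi> v $ x" for x
    using policy_value_fixpoint[OF assms(1-4)] by (simp add: v_def)
  have "0 \<le> (W - v) $ x"
  proof (rule superharmonic_nonneg[OF assms(1-4)])
    show "\<alpha> * (trans_mat M \<phi> *v (W - v)) $ y \<le> (W - v) $ y" for y
      using assms(5)[of y] v[of y]
      by (simp add: bellman_def matrix_vector_mult_diff_distrib algebra_simps)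
  qed
  then show ?thesis by (simp add: v_def)
qed

lemma policy_value_unique:
  assumes "finite_mdp M" "\<phi> \<in> decision_rules M" "0 \<le> \<alpha>" "\<alpha> < 1"
    and "W = bellman M \<alpha> \<phi> W"
  shows "W = policy_value M \<alpha> \<phi>"
proof -
  define v where "v = policy_value M \<alpha> \<phi>"
  have v: "v = bellman M \<alpha> \<phi> v"
    using policy_value_fixpoint[OF assms(1-4)] by (simp add: v_def)
  have "W - v = bellman M \<alpha> \<phi> W - bellman M \<alpha> \<phi> v"
    using v assms(5) by metis
  also have "\<dots> = \<alpha> *\<^sub>R (trans_mat M \<phi> *v (W - v))"
    by (simp add: bellman_def matrix_vector_mult_diff_distrib algebra_simps)
  finally have "W - v = 0" by (rule harmonic_zero[OF assms(1-4)])
  then show ?thesis by (simp add: v_def)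
qed

text \<open>The value solves the linear system with matrix I - \<alpha>P and right-hand side
  \<open>r\<close>, whose entries are affine in \<alpha> or constant. A single rational function
  therefore works on all of [0,1).\<close>

lemma pw_rat_policy_value:
  fixes M :: "('x::finite, 'a) mdp"
  assumes "finite_mdp M" "\<phi> \<in> decision_rules M"
  shows "pw_rat (\<lambda>\<alpha>. policy_value M \<alpha> \<phi> $ x)"
proof -
  define P where "P = trans_mat M \<phi>"
  define r where "r = reward_vec M \<phi>"
  define A where "A \<alpha> = (\<chi> i j. (if i = j then 1 else 0) - \<alpha> * P $ i $ j)" for \<alpha>
  have A: "A \<alpha> *v v = v - \<alpha> *\<^sub>R (P *v v)" for \<alpha> v
    by (simp add: A_def vec_eq_iff matrix_vector_mult_def left_diff_distrib sum_subtractf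
        sum_distrib_left mult.assoc if_distrib[of "\<lambda>c. c * _"] cong: if_cong)
  have det: "det (A \<alpha>) \<noteq> 0" if "\<alpha> \<in> {0..<1}" for \<alpha>
  proof -
    \<comment> \<open>A trivial kernel gives a left inverse, and multiplicativity of the determinant
      then excludes the value 0.\<close>
    have "u = 0" if "A \<alpha> *v u = 0" for u
    proof (rule harmonic_zero[OF assms])
      show "u = \<alpha> *\<^sub>R (trans_mat M \<phi> *v u)" using that unfolding A by (simp add: P_def)
    qed (use \<open>\<alpha> \<in> {0..<1}\<close> in auto)
    then have "\<exists>B. B ** A \<alpha> = mat 1" by (simp add: matrix_left_invertible_ker)
    then show ?thesis by (metis det_I det_mul mult_zero_right zero_neq_one)
  qed
  let ?num = "\<lambda>\<alpha>. det (\<chi> i j. if j = x then r $ i else A \<alpha> $ i $ j)"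
  have rat_A: "rat_fun (\<lambda>\<alpha>. A \<alpha> $ i $ j)" for i j
    unfolding A_def vec_lambda_beta by (intro rat_fun_diff rat_fun_mult rat_fun_const rat_fun_ident)
  have "rat_fun (\<lambda>\<alpha>. (\<chi> i j. if j = x then r $ i else A \<alpha> $ i $ j) $ i $ j)" for i j
    by (cases "j = x") (simp_all add: rat_A rat_fun_const)
  then have rat: "rat_fun (\<lambda>\<alpha>. ?num \<alpha> / det (A \<alpha>))"
    by (intro rat_fun_divide rat_fun_det rat_A det)
  have "policy_value M \<alpha> \<phi> $ x = ?num \<alpha> / det (A \<alpha>)" if "\<alpha> \<in> {0..<1}" for \<alpha>
  proof -
    have "policy_value M \<alpha> \<phi> = bellman M \<alpha> \<phi> (policy_value M \<alpha> \<phi>)"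
      using that by (intro policy_value_fixpoint assms) auto
    then have "A \<alpha> *v policy_value M \<alpha> \<phi> = r"
      unfolding A bellman_def P_def r_def by (metis add_diff_cancel_right')
    then show ?thesis using cramer[OF det[OF that]] by simp
  qed
  then have "rat_fun (\<lambda>\<alpha>. policy_value M \<alpha> \<phi> $ x)"
    using rat unfolding rat_fun_def by simp
  then show ?thesis by (rule rat_fun_imp_pw_rat)
qed

section \<open>Value iteration\<close>

lemma bellman_nth:
  "bellman M \<alpha> \<phi> V $ x = reward M x (\<phi> x) + \<alpha> * (\<Sum>y\<in>UNIV. trans M x (\<phi> x) y * V $ y)"
  by (simp add: bellman_def reward_vec_def trans_mat_def matrix_vector_mult_def)

lemma bellman_le_value_iter:
  assumes "finite_mdp M" "\<phi> \<in> decision_rules M"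
  shows "bellman M \<alpha> \<phi> (value_iter M \<alpha> n) $ x \<le> value_iter M \<alpha> (Suc n) $ x"
  using assms by (simp add: finite_decision_rules)

text \<open>The maxima at different states may be attained by different rules. The diagonal rule
  \<open>\<lambda>x. \<Psi> x x\<close> attains all of them, because the Bellman value at a state
  depends on the rule only through its action there.\<close>

lemma opt_rules_at_nonempty:
  assumes "finite_mdp M"
  shows "opt_rules_at M \<alpha> (Suc n) \<noteq> {}"
proof -
  let ?V = "value_iter M \<alpha> n"
  have "\<exists>\<psi>\<in>decision_rules M. value_iter M \<alpha> (Suc n) $ x = bellman M \<alpha> \<psi> ?V $ x" for x
  proof -
    have "Max ((\<lambda>\<phi>. bellman M \<alpha> \<phi> ?V $ x) ` decision_rules M)
        \<in> (\<lambda>\<phi>. bellman M \<alpha> \<phi> ?V $ x) ` decision_rules M"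
      using assms by (intro Max_in) (auto simp: finite_decision_rules decision_rules_nonempty)
    then show ?thesis by auto
  qed
  then obtain \<Psi> where \<Psi>: "\<And>x. \<Psi> x \<in> decision_rules M"
    "\<And>x. value_iter M \<alpha> (Suc n) $ x = bellman M \<alpha> (\<Psi> x) ?V $ x"
    by metis
  have "(\<lambda>x. \<Psi> x x) \<in> opt_rules_at M \<alpha> (Suc n)"
    using \<Psi>(1) unfolding opt_rules_at_def
    by (auto simp: decision_rules_def vec_eq_iff \<Psi>(2) bellman_nth simp del: value_iter.simps)
  then show ?thesis by blast
qed

lemma pw_rat_bellman:
  assumes "\<And>y. pw_rat (\<lambda>\<alpha>. V \<alpha> $ y)"
  shows "pw_rat (\<lambda>\<alpha>. bellman M \<alpha> \<phi> (V \<alpha>) $ x)"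
  unfolding bellman_nth
  by (intro pw_rat_add pw_rat_mult pw_rat_sum assms rat_fun_imp_pw_rat[OF rat_fun_const]
      rat_fun_imp_pw_rat[OF rat_fun_ident])

lemma pw_rat_value_iter:
  assumes "finite_mdp M"
  shows "pw_rat (\<lambda>\<alpha>. value_iter M \<alpha> n $ x)"
proof (induction n arbitrary: x)
  case 0
  show ?case by (simp add: rat_fun_imp_pw_rat rat_fun_const)
next
  case (Suc n)
  then show ?case
    using assms
    by (simp add: pw_rat_Max pw_rat_bellman finite_decision_rules decision_rules_nonempty)
qed

text \<open>The new increment is compared with the effect of one fixed rule on the old one: a rule
  that is maximizing at the later step bounds it from above, a rule that is maximizing at the
  earlier step from below. A fixed rule contracts by the factor \<alpha>.\<close>

lemma value_iter_step:
  assumes "finite_mdp M" "0 \<le> \<alpha>" "\<And>y. \<bar>value_iter M \<alpha> (Suc n) $ y - value_iter M \<alpha> n $ y\<bar> \<le> c"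
  shows "\<bar>value_iter M \<alpha> (Suc (Suc n)) $ x - value_iter M \<alpha> (Suc n) $ x\<bar> \<le> \<alpha> * c"
proof -
  let ?V = "value_iter M \<alpha>"
  have close: "\<bar>bellman M \<alpha> \<phi> (?V (Suc n)) $ x - bellman M \<alpha> \<phi> (?V n) $ x\<bar> \<le> \<alpha> * c"
    if "\<phi> \<in> decision_rules M" for \<phi>
  proof -
    have "bellman M \<alpha> \<phi> (?V (Suc n)) $ x - bellman M \<alpha> \<phi> (?V n) $ x
        = \<alpha> * (trans_mat M \<phi> *v (?V (Suc n) - ?V n)) $ x"
      by (simp add: bellman_def matrix_vector_mult_diff_distrib algebra_simps del: value_iter.simps)
    moreover have "\<bar>(trans_mat M \<phi> *v (?V (Suc n) - ?V n)) $ x\<bar> \<le> c"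
      using assms(3) by (intro trans_mat_abs_le assms(1) that) (simp del: value_iter.simps)
    ultimately show ?thesis using assms(2) by (simp add: abs_mult mult_left_mono del: value_iter.simps)
  qed
  obtain \<phi> \<psi> where \<phi>: "\<phi> \<in> decision_rules M" "?V (Suc (Suc n)) = bellman M \<alpha> \<phi> (?V (Suc n))"
    and \<psi>: "\<psi> \<in> decision_rules M" "?V (Suc n) = bellman M \<alpha> \<psi> (?V n)"
    using opt_rules_at_nonempty[OF assms(1), of \<alpha> n]
      opt_rules_at_nonempty[OF assms(1), of \<alpha> "Suc n"]
    by (auto simp: opt_rules_at_def simp del: value_iter.simps)
  have "?V (Suc (Suc n)) $ x - ?V (Suc n) $ x
      \<le> bellman M \<alpha> \<phi> (?V (Suc n)) $ x - bellman M \<alpha> \<phi> (?V n) $ x"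
    using \<phi> bellman_le_value_iter[OF assms(1) \<phi>(1), of \<alpha> n x] by simp
  moreover have "?V (Suc (Suc n)) $ x - ?V (Suc n) $ x
      \<ge> bellman M \<alpha> \<psi> (?V (Suc n)) $ x - bellman M \<alpha> \<psi> (?V n) $ x"
    using \<psi> bellman_le_value_iter[OF assms(1) \<psi>(1), of \<alpha> "Suc n" x] by simp
  ultimately show ?thesis using close[OF \<phi>(1)] close[OF \<psi>(1)] by linarith
qed

text \<open>The increments decay geometrically, so each coordinate converges as a telescoping
  series. The limit is not identified here; \<open>turnpike_exists\<close> does that through its
  Bellman equation.\<close>

lemma value_iter_convergent:
  assumes "finite_mdp M" "0 \<le> \<alpha>" "\<alpha> < 1"
  shows "\<exists>W. value_iter M \<alpha> \<longlonglongrightarrow> W"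
proof -
  let ?V = "value_iter M \<alpha>"
  define B where "B = Max (range (\<lambda>x. \<bar>?V 1 $ x - ?V 0 $ x\<bar>))"
  have bound: "\<bar>?V (Suc n) $ x - ?V n $ x\<bar> \<le> \<alpha> ^ n * B" for n x
  proof (induction n arbitrary: x)
    case 0
    show ?case by (simp add: B_def del: value_iter.simps)
  next
    case (Suc n)
    then show ?case
      using value_iter_step[OF assms(1,2) Suc] by (simp add: mult.assoc del: value_iter.simps)
  qed
  have "\<exists>w. (\<lambda>n. ?V n $ x) \<longlonglongrightarrow> w" for x
  proof -
    have "summable (\<lambda>n. ?V (Suc n) $ x - ?V n $ x)"
    proof (rule summable_comparison_test'[where N = 0])
      show "summable (\<lambda>n. \<alpha> ^ n * B)"
        using assms by (intro summable_mult2 summable_geometric) auto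
    qed (use bound in simp)
    then have "convergent (\<lambda>n. \<Sum>k<n. ?V (Suc k) $ x - ?V k $ x)"
      by (simp add: summable_iff_convergent)
    then have "convergent (\<lambda>n. ?V n $ x - ?V 0 $ x)"
      by (simp only: sum_lessThan_telescope[of "\<lambda>n. ?V n $ x"])
    then obtain l where "(\<lambda>n. ?V n $ x - ?V 0 $ x) \<longlonglongrightarrow> l" by (auto simp: convergent_def)
    then have "(\<lambda>n. ?V n $ x - ?V 0 $ x + ?V 0 $ x) \<longlonglongrightarrow> l + ?V 0 $ x"
      by (intro tendsto_add tendsto_const)
    then show ?thesis by auto
  qed
  then obtain w where "\<And>x. (\<lambda>n. ?V n $ x) \<longlonglongrightarrow> w x" by metis
  then have "?V \<longlonglongrightarrow> (\<chi> x. w x)" by (intro vec_tendstoI) simp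
  then show ?thesis by blast
qed

text \<open>The maximum is taken separately at each state, so one rule attains it everywhere as soon
  as it dominates all others at every state.\<close>

lemma opt_value_eqI:
  assumes "finite_mdp M" "\<phi> \<in> decision_rules M"
    and "\<And>\<psi> x. \<psi> \<in> decision_rules M \<Longrightarrow> policy_value M \<alpha> \<psi> $ x \<le> policy_value M \<alpha> \<phi> $ x"
  shows "opt_value M \<alpha> = policy_value M \<alpha> \<phi>"
  unfolding opt_value_def vec_eq_iff using assms
  by (auto intro!: Max_eqI simp: finite_decision_rules)

lemma opt_value_ge:
  assumes "finite_mdp M" "\<psi> \<in> decision_rules M"
  shows "policy_value M \<alpha> \<psi> $ x \<le> opt_value M \<alpha> $ x"
  using assms by (simp add: opt_value_def finite_decision_rules)

text \<open>The limit of value iteration is a fixed point of every rule that is maximizing infinitely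
  often.\<close>

lemma turnpike_exists:
  assumes M: "finite_mdp M" and \<alpha>: "0 \<le> \<alpha>" "\<alpha> < 1"
  shows "\<exists>N\<ge>1. \<forall>n\<ge>N. opt_rules_at M \<alpha> n \<subseteq> opt_rules M \<alpha>"
proof -
  let ?V = "value_iter M \<alpha>" and ?D = "opt_rules_at M \<alpha>"
  obtain W where W: "?V \<longlonglongrightarrow> W" using value_iter_convergent[OF M \<alpha>] by blast
  have bW: "(\<lambda>n. bellman M \<alpha> \<psi> (?V n)) \<longlonglongrightarrow> bellman M \<alpha> \<psi> W" for \<psi>
    unfolding bellman_def
    by (intro tendsto_intros bounded_linear.tendsto[OF matrix_vector_mul_bounded_linear] W)
  \<comment> \<open>The inequality holds along the iteration and survives the passage to the limit;
    it makes \<open>W\<close> an upper bound for all policy values.\<close>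
  have super: "bellman M \<alpha> \<psi> W $ x \<le> W $ x" if "\<psi> \<in> decision_rules M" for \<psi> x
    using bellman_le_value_iter[OF M that]
    by (intro LIMSEQ_le[OF tendsto_vec_nth[OF bW] tendsto_vec_nth[OF LIMSEQ_Suc[OF W]]]) blast
  have opt: "\<phi> \<in> opt_rules M \<alpha>"
    if inf: "\<exists>\<^sub>\<infinity>n. \<phi> \<in> ?D (Suc n)" and \<phi>: "\<phi> \<in> decision_rules M" for \<phi>
  proof -
    have "(\<lambda>n. ?V (Suc n) - bellman M \<alpha> \<phi> (?V n)) \<longlonglongrightarrow> W - bellman M \<alpha> \<phi> W"
      by (intro tendsto_diff LIMSEQ_Suc W bW)
    moreover have "\<exists>\<^sub>F n in sequentially. ?V (Suc n) - bellman M \<alpha> \<phi> (?V n) = 0"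
      using inf unfolding cofinite_eq_sequentially
      by (rule frequently_elim1) (auto simp: opt_rules_at_def simp del: value_iter.simps)
    \<comment> \<open>A convergent sequence that vanishes infinitely often cannot have a nonzero
      limit.\<close>
    ultimately have "W - bellman M \<alpha> \<phi> W = 0"
      using tendsto_imp_eventually_ne unfolding frequently_def by blast
    then have "W = policy_value M \<alpha> \<phi>"
      by (intro policy_value_unique M \<phi> \<alpha>) simp
    moreover have "policy_value M \<alpha> \<psi> $ x \<le> W $ x" if "\<psi> \<in> decision_rules M" for \<psi> x
      by (intro policy_value_le M \<alpha> that super)
    ultimately have "opt_value M \<alpha> = policy_value M \<alpha> \<phi>"
      by (intro opt_value_eqI M \<phi>) metis
    with \<phi> show ?thesis by (simp add: opt_rules_def)
  qed
  \<comment> \<open>A rule that is maximizing only finitely often satisfies the implication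
    vacuously from some index on. Finiteness of the set of rules then gives a common
    threshold.\<close>
  have "\<forall>\<^sub>\<infinity>n. \<phi> \<in> ?D (Suc n) \<longrightarrow> \<phi> \<in> opt_rules M \<alpha>" if "\<phi> \<in> decision_rules M" for \<phi>
  proof (cases "\<exists>\<^sub>\<infinity>n. \<phi> \<in> ?D (Suc n)")
    case True
    with that opt show ?thesis by simp
  next
    case False
    then show ?thesis unfolding not_INFM by (rule MOST_mono) simp
  qed
  then have "\<forall>\<^sub>\<infinity>n. \<forall>\<phi>\<in>decision_rules M. \<phi> \<in> ?D (Suc n) \<longrightarrow> \<phi> \<in> opt_rules M \<alpha>"
    by (simp add: eventually_ball_finite_distrib finite_decision_rules[OF M])
  then obtain N where N: "\<And>n. n \<ge> N \<Longrightarrow> ?D (Suc n) \<subseteq> opt_rules M \<alpha>"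
    unfolding MOST_nat_le by (auto simp: opt_rules_at_def simp del: value_iter.simps)
  show ?thesis
  \<comment> \<open>The shift keeps the threshold positive and matches the index
    \<open>Suc n\<close> used above; at 0 the truncated subtraction in \<open>opt_rules_at\<close>
    would compare the terminal reward with its own Bellman image.\<close>
  proof (intro exI[of _ "Suc N"] conjI allI impI)
    fix n assume "Suc N \<le> n"
    then obtain k where "n = Suc k" "N \<le> k" by (metis Suc_le_D Suc_le_mono)
    with N show "?D n \<subseteq> opt_rules M \<alpha>" by simp
  qed simp
qed

section \<open>Tameness of the turnpike integer\<close>

lemma tame_opt_rules_at:
  assumes "finite_mdp M"
  shows "tame (\<lambda>\<alpha>. \<phi> \<in> opt_rules_at M \<alpha> n)"
proof (cases "\<phi> \<in> decision_rules M")
  case True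
  have "tame (\<lambda>\<alpha>. \<forall>x\<in>UNIV. value_iter M \<alpha> n $ x = bellman M \<alpha> \<phi> (value_iter M \<alpha> (n - 1)) $ x)"
    by (intro tame_ball tame_eq pw_rat_bellman pw_rat_value_iter assms) simp
  then show ?thesis
    by (rule tame_cong) (simp add: opt_rules_at_def True vec_eq_iff)
next
  case False
  then show ?thesis by (auto simp: opt_rules_at_def tame_def)
qed

text \<open>Optimality is rewritten as domination over every rule at every state, a finite
  conjunction of inequalities between policy values.\<close>

lemma tame_opt_rules:
  assumes "finite_mdp M"
  shows "tame (\<lambda>\<alpha>. \<phi> \<in> opt_rules M \<alpha>)"
proof (cases "\<phi> \<in> decision_rules M")
  case True
  have "tame (\<lambda>\<alpha>. \<forall>\<psi>\<in>decision_rules M. \<forall>x\<in>UNIV. policy_value M \<alpha> \<psi> $ x \<le> policy_value M \<alpha> \<phi> $ x)"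
    by (intro tame_ball tame_le pw_rat_policy_value assms finite_decision_rules True) simp
  then show ?thesis
  proof (rule tame_cong)
    show "(\<forall>\<psi>\<in>decision_rules M. \<forall>x\<in>UNIV. policy_value M \<alpha> \<psi> $ x \<le> policy_value M \<alpha> \<phi> $ x)
        \<longleftrightarrow> \<phi> \<in> opt_rules M \<alpha>" for \<alpha>
      using opt_value_eqI[OF assms True, of \<alpha>] opt_value_ge[OF assms, of _ \<alpha>] True
      by (auto simp: opt_rules_def)
  qed
next
  case False
  then show ?thesis by (auto simp: opt_rules_def tame_def)
qed

lemma tame_opt_rules_subset:
  assumes "finite_mdp M"
  shows "tame (\<lambda>\<alpha>. opt_rules_at M \<alpha> n \<subseteq> opt_rules M \<alpha>)"
proof -
  have "tame (\<lambda>\<alpha>. \<forall>\<phi>\<in>decision_rules M. \<phi> \<in> opt_rules_at M \<alpha> n \<longrightarrow> \<phi> \<in> opt_rules M \<alpha>)"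
    by (intro tame_ball tame_imp tame_opt_rules_at tame_opt_rules assms finite_decision_rules)
  then show ?thesis
    by (rule tame_cong) (auto simp: opt_rules_at_def)
qed

lemma opt_rules_at_subset:
  assumes "finite_mdp M" "0 \<le> \<alpha>" "\<alpha> < 1" "turnpike_integer M \<alpha> \<le> n"
  shows "opt_rules_at M \<alpha> n \<subseteq> opt_rules M \<alpha>"
proof -
  have "1 \<le> turnpike_integer M \<alpha> \<and>
      (\<forall>n\<ge>turnpike_integer M \<alpha>. opt_rules_at M \<alpha> n \<subseteq> opt_rules M \<alpha>)"
    unfolding turnpike_integer_def by (rule LeastI_ex) (use turnpike_exists[OF assms(1-3)] in blast)
  with assms(4) show ?thesis by blast
qed

lemma turnpike_partition:
  assumes M: "finite_mdp M" and I: "discount_interval I"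
    and K: "\<And>\<alpha>. \<alpha> \<in> I \<Longrightarrow> turnpike_integer M \<alpha> \<le> K"
  shows "\<exists>\<P>. finite \<P> \<and> partition_on I \<P> \<and> (\<forall>J\<in>\<P>. turnpike_interval M J)"
proof -
  have I01: "I \<subseteq> {0..<1}" and Iint: "is_interval I" using I by (auto simp: discount_interval_def)
  obtain F where F: "finite F"
    "\<And>n a b. n \<in> {..<K} \<Longrightarrow> 0 \<le> a \<Longrightarrow> a \<le> b \<Longrightarrow> b < 1 \<Longrightarrow> {a..b} \<inter> F = {} \<Longrightarrow>
      (opt_rules_at M a n \<subseteq> opt_rules M a) = (opt_rules_at M b n \<subseteq> opt_rules M b)"
    using tame_common[of "{..<K}" "\<lambda>n \<alpha>. opt_rules_at M \<alpha> n \<subseteq> opt_rules M \<alpha>",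
        OF finite_lessThan tame_opt_rules_subset[OF M]] by blast
  have const: "turnpike_integer M a = turnpike_integer M b"
    if "a \<in> I" "b \<in> I" "a \<le> b" "{a..b} \<inter> F = {}" for a b
  proof -
    have ab: "0 \<le> a" "a < 1" "0 \<le> b" "b < 1" using that I01 by auto
    have "(opt_rules_at M a n \<subseteq> opt_rules M a) = (opt_rules_at M b n \<subseteq> opt_rules M b)" for n
    proof (cases "n < K")
      case True
      then show ?thesis using F(2) ab that by simp
    next
      case False
      \<comment> \<open>From \<open>K\<close> on both inclusions are true, so they agree whatever
        \<open>F\<close> is.\<close>
      then have "turnpike_integer M a \<le> n" "turnpike_integer M b \<le> n"
        using K[OF that(1)] K[OF that(2)] by auto
      then show ?thesis using opt_rules_at_subset[OF M] ab by blast
    qed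
    \<comment> \<open>The discount factor enters the \<open>LEAST\<close> expression only through
      the truth values of the inclusions, so both sides minimize over the same set.\<close>
    then show ?thesis by (simp add: turnpike_integer_def)
  qed
  obtain \<P> where P: "finite \<P>" "partition_on I \<P>"
    "\<And>J. J \<in> \<P> \<Longrightarrow> is_interval J"
    "\<And>J a b. J \<in> \<P> \<Longrightarrow> a \<in> J \<Longrightarrow> b \<in> J \<Longrightarrow> a < b \<Longrightarrow> {a..b} \<inter> F = {}"
    using finite_interval_partition[OF F(1) Iint] by blast
  have "turnpike_interval M J" if J: "J \<in> \<P>" for J
  proof -
    have JI: "J \<subseteq> I" and ne: "J \<noteq> {}" using P(2) J by (auto simp: partition_on_def)
    have "turnpike_integer M a = turnpike_integer M b" if "a \<in> J" "b \<in> J" for a b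
    proof (cases a b rule: linorder_cases)
      case less
      with that JI P(4)[OF J that] show ?thesis by (intro const) auto
    next
      case greater
      with that JI P(4)[OF J that(2,1)] show ?thesis by (intro const[symmetric]) auto
    qed simp
    then have "turnpike_integer M constant_on J" unfolding constant_on_def by metis
    with JI ne I01 P(3)[OF J] show ?thesis
      unfolding turnpike_interval_def discount_interval_def by auto
  qed
  with P show ?thesis by blast
qed

theorem theorem4p13:
  fixes M :: "('x::finite, 'a) mdp" and I :: "real set"
  assumes "finite_mdp M"
    and "discount_interval I"
  shows "(\<exists>\<P>. finite \<P> \<and> partition_on I \<P> \<and> (\<forall>J\<in>\<P>. turnpike_interval M J))
         \<longleftrightarrow> sup_turnpike M I < \<infinity>"
proof
  assume "\<exists>\<P>. finite \<P> \<and> partition_on I \<P> \<and> (\<forall>J\<in>\<P>. turnpike_interval M J)"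
  then obtain \<P> where P: "finite \<P>" "I = \<Union>\<P>" "\<And>J. J \<in> \<P> \<Longrightarrow> turnpike_integer M constant_on J"
    unfolding partition_on_def turnpike_interval_def by metis
  \<comment> \<open>Each piece contributes at most one value; the finitely many values on
    \<open>I\<close> have a maximum, which bounds the supremum.\<close>
  have "finite (turnpike_integer M ` J)" if J: "J \<in> \<P>" for J
  proof -
    obtain c where "\<And>\<alpha>. \<alpha> \<in> J \<Longrightarrow> turnpike_integer M \<alpha> = c"
      using P(3)[OF J] by (auto simp: constant_on_def)
    then have "turnpike_integer M ` J \<subseteq> {c}" by auto
    then show ?thesis by (rule finite_subset) simp
  qed
  then have "finite (turnpike_integer M ` I)" using P(1,2) by (simp add: image_Union)
  then have "turnpike_integer M \<alpha> \<le> Max (turnpike_integer M ` I)" if "\<alpha> \<in> I" for \<alpha>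
    using that by simp
  then have "sup_turnpike M I \<le> enat (Max (turnpike_integer M ` I))"
    unfolding sup_turnpike_def by (intro SUP_least) simp
  then show "sup_turnpike M I < \<infinity>" by (rule order.strict_trans1) simp
next
  assume "sup_turnpike M I < \<infinity>"
  \<comment> \<open>A supremum below infinity in \<open>enat\<close> is a natural number, which
    serves as the uniform bound on \<open>I\<close>.\<close>
  then obtain K where K: "sup_turnpike M I = enat K" by (cases "sup_turnpike M I") auto
  have "turnpike_integer M \<alpha> \<le> K" if "\<alpha> \<in> I" for \<alpha>
    using SUP_upper[OF that, of "\<lambda>\<alpha>. enat (turnpike_integer M \<alpha>)"] K
    by (simp add: sup_turnpike_def)
  then show "\<exists>\<P>. finite \<P> \<and> partition_on I \<P> \<and> (\<forall>J\<in>\<P>. turnpike_interval M J)"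
    by (rule turnpike_partition[OF assms])
qed

end
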